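(* Let $G$ be an abelian group (written additively), let $A \subseteq G$ be a finite set, and set $H = \mathrm{stab}(\Sigma(A))$. Then $$|\Sigma(A)| \ge |H| + \tfrac{1}{64}|A \setminus H|^2.$$
   Context: For a finite set $A\subseteq G$, $\Sigma(A) = \{\sum_{a\in A'} a : A' \subseteq A\}$ is the set of all subset sums of $A$ (the empty sum being $0$). For $X \subseteq G$, $\mathrm{stab}(X) = \{g \in G : g + X = X\}$, a subgroup of $G$. *)

theory Defs
  imports Complex_Main
begin

text \<open>The ambient abelian group is the whole type, of class \<^class>\<open>ab_group_add\<close>.\<close>

definition subset_sums :: "'a::ab_group_add set \<Rightarrow> 'a set" where
  "subset_sums A = {\<Sum>a\<in>B. a | B. B \<subseteq> A}"

definition stab :: "'a::ab_group_add set \<Rightarrow> 'a set" where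
  "stab X = {g. (\<lambda>x. g + x) ` X = X}"

text \<open>For finite \<open>A\<close>, both \<open>subset_sums A\<close> and its stabilizer are finite, so that
  \<^const>\<open>card\<close> is the true cardinality of each.\<close>

lemma zero_in_subset_sums: "0 \<in> subset_sums A"
  unfolding subset_sums_def by (force intro: exI[of _ "{}"])

lemma finite_subset_sums: "finite A \<Longrightarrow> finite (subset_sums A)"
  unfolding subset_sums_def by (simp add: setcompr_eq_image flip: Pow_def)

lemma finite_stab_subset_sums:
  assumes "finite A"
  shows "finite (stab (subset_sums A))"
proof (rule finite_subset)
  show "stab (subset_sums A) \<subseteq> subset_sums A"
  proof
    fix g assume "g \<in> stab (subset_sums A)"
    then have "(\<lambda>x. g + x) ` subset_sums A = subset_sums A"
      by (simp add: stab_def)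
    moreover have "g + 0 \<in> (\<lambda>x. g + x) ` subset_sums A"
      by (rule imageI) (rule zero_in_subset_sums)
    ultimately show "g \<in> subset_sums A" by simp
  qed
qed (rule finite_subset_sums[OF assms])

end

theory Submission
  imports Defs "HOL-Library.Set_Algebras"
begin

text \<open>Everything is done relative to the finite subgroup \<open>H\<close>, for \<open>A\<close> disjoint from \<open>H\<close> and
  the \<open>H\<close>-periodic sets \<open>\<Sigma>(B) + H\<close>, which avoids passing to the quotient by \<open>H\<close>. Since no
  element of \<open>A\<close> stabilizes any \<open>\<Sigma>(B) + H\<close> with \<open>B \<subseteq> A\<close>, adding elements one at a time
  gives a linear bound, which suffices when \<open>n = |A| \<le> 64\<close>. If a subgroup \<open>L \<supseteq> H\<close> not
  containing \<open>A\<close> contains at least \<open>n / \<surd>2\<close> elements of \<open>A\<close>, then \<open>\<Sigma>(A) + H\<close> contains two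
  disjoint translates of \<open>\<Sigma>(A \<inter> L) + H\<close>, and induction applies. Otherwise every \<open>C \<subseteq> A\<close>
  with \<open>|C| \<ge> n / \<surd>2\<close> generates, together with \<open>H\<close>, the same subgroup as \<open>A\<close>, and \<open>B\<close> is
  built greedily: by a lemma of Olson some \<open>c\<close> in \<open>C = A - B\<close> enlarges \<open>X = \<Sigma>(B) + H\<close> by at
  least \<open>min(|X| / 2, |C| / 8)\<close>. Doing this for the first \<open>2n/7\<close> elements is enough.\<close>

section \<open>Subgroups, translates and stabilizers\<close>

text \<open>A predicate on sets that is closed under intersection, so that
  \<open>subgrp hull S\<close> is the subgroup generated by \<open>S\<close>.\<close>

definition subgrp :: "'a::ab_group_add set \<Rightarrow> bool" where
  "subgrp K \<longleftrightarrow> 0 \<in> K \<and> (\<forall>x\<in>K. \<forall>y\<in>K. x - y \<in> K)"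

lemma subgrp_zero: "subgrp K \<Longrightarrow> 0 \<in> K"
  by (simp add: subgrp_def)

lemma subgrp_diff: "subgrp K \<Longrightarrow> x \<in> K \<Longrightarrow> y \<in> K \<Longrightarrow> x - y \<in> K"
  by (simp add: subgrp_def)

lemma subgrp_minus: "subgrp K \<Longrightarrow> x \<in> K \<Longrightarrow> - x \<in> K"
  using subgrp_diff[of K 0 x] by (simp add: subgrp_zero)

lemma subgrp_add: "subgrp K \<Longrightarrow> x \<in> K \<Longrightarrow> y \<in> K \<Longrightarrow> x + y \<in> K"
  using subgrp_diff[of K x "- y"] by (simp add: subgrp_minus)

lemma subgrp_add_cancel: "subgrp K \<Longrightarrow> y \<in> K \<Longrightarrow> x + y \<in> K \<longleftrightarrow> x \<in> K"
  using subgrp_add[of K x y] subgrp_diff[of K "x + y" y] by auto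

lemma subgrp_hull: "subgrp (subgrp hull S)"
  by (rule hull_in) (auto simp: subgrp_def)

lemma subgrp_sum: "subgrp K \<Longrightarrow> B \<subseteq> K \<Longrightarrow> \<Sum>B \<in> K"
  by (induction B rule: infinite_finite_induct) (auto simp: subgrp_zero subgrp_add)

lemma subgrp_set_plus: "subgrp K \<Longrightarrow> A \<subseteq> K \<Longrightarrow> B \<subseteq> K \<Longrightarrow> A + B \<subseteq> K"
  by (fastforce simp: set_plus_def intro: subgrp_add)

lemma subgrp_plus_self: "subgrp K \<Longrightarrow> K + K = K"
  using subgrp_set_plus[of K K K] set_zero_plus2[of K K] by (auto simp: subgrp_zero)

lemma mem_translate: "x \<in> (+) g ` X \<longleftrightarrow> x - g \<in> X"
  for g :: "'a::ab_group_add"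
  by (auto intro: image_eqI[of _ _ "x - g"])

lemma card_translate: "card ((+) g ` X) = card X"
  for g :: "'a::ab_group_add"
  by (simp add: card_image)

lemma translate_set_plus: "(+) g ` X + Y = (+) g ` (X + Y)"
  for g :: "'a::ab_group_add"
  by (force simp: set_plus_def mem_translate algebra_simps)

lemma translate_subset_eq:
  fixes g :: "'a::ab_group_add"
  assumes "finite X" "(+) g ` X \<subseteq> X"
  shows "(+) g ` X = X"
  using assms by (simp add: card_subset_eq card_translate)

lemma stab_iff: "g \<in> stab X \<longleftrightarrow> (+) g ` X = X"
  by (simp add: stab_def)

lemma stab_add_mem: "g \<in> stab X \<Longrightarrow> x \<in> X \<Longrightarrow> g + x \<in> X"
  by (auto simp: stab_def)

lemma subgrp_stab: "subgrp (stab X)"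
  unfolding subgrp_def
proof (intro conjI ballI)
  show "0 \<in> stab X" by (simp add: stab_iff)
next
  fix g h assume g: "g \<in> stab X" and h: "h \<in> stab X"
  have "(+) (- h) ` X = (+) (- h) ` ((+) h ` X)"
    using h by (simp add: stab_iff)
  also have "\<dots> = X" by (simp add: image_image)
  finally have "(+) (- h) ` X = X" .
  then have "(+) g ` ((+) (- h) ` X) = X" using g by (simp add: stab_iff)
  then show "g - h \<in> stab X" by (simp add: stab_iff image_image algebra_simps)
qed

lemma stab_set_plus: "stab X \<subseteq> stab (X + Y)"
  by (auto simp: stab_iff simp flip: translate_set_plus)

section \<open>Expansion under a symmetric generating set\<close>

lemma card_subset_set_plus:
  fixes A :: "'a::ab_group_add set"
  assumes "finite A" "finite B" "a \<in> A"
  shows "card B \<le> card (A + B)"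
proof -
  have "(+) a ` B \<subseteq> A + B" using assms(3) by auto
  then show ?thesis using card_mono[OF finite_set_plus[OF assms(1,2)]] by (metis card_translate)
qed

text \<open>The proof minimises first the boundary \<open>card (F + S) - card F\<close> and then the size of \<open>F\<close>:
  by submodularity such an \<open>F\<close> (an atom in Hamidoune's terminology) is a coset of its
  stabilizer. If \<open>F \<union> (g + F)\<close> expands to the whole subgroup, the complement of \<open>F + S\<close> is
  a second minimiser, hence not smaller than \<open>F\<close>.\<close>

lemma sumset_growth:
  fixes S :: "'a::ab_group_add set"
  assumes S: "finite S" "0 \<in> S" "\<And>x. x \<in> S \<Longrightarrow> - x \<in> S"
    and K: "K = subgrp hull S"
    and A: "finite A" "A \<noteq> {}" "A \<subseteq> K" "A + S \<noteq> K"
  shows "2 * card A + card S \<le> 2 * card (A + S)"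
proof -
  have sK: "subgrp K" unfolding K by (rule subgrp_hull)
  have SK: "S \<subseteq> K" unfolding K by (rule hull_subset)
  define P where "P F \<longleftrightarrow> F \<subseteq> K \<and> finite F \<and> F \<noteq> {} \<and> F + S \<noteq> K" for F
  define bd where "bd F = card (F + S) - card F" for F
  have sub: "F \<subseteq> F + S" for F using set_zero_plus2[OF S(2), of F] by (simp add: add.commute)
  have fin: "finite (F + S)" if "finite F" for F using that S(1) by (rule finite_set_plus)
  have bd: "card (F + S) = card F + bd F" if "finite F" for F
    using card_mono[OF fin[OF that] sub] by (simp add: bd_def)
  have PA: "P A" using A by (simp add: P_def)
  obtain F0 where F0: "P F0" "\<And>E. P E \<Longrightarrow> bd F0 \<le> bd E"
    using ex_has_least_nat[of P A bd] PA by blast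
  obtain F where F: "P F" "bd F = bd F0" "\<And>E. P E \<Longrightarrow> bd E = bd F0 \<Longrightarrow> card F \<le> card E"
    using ex_has_least_nat[of "\<lambda>E. P E \<and> bd E = bd F0" F0 card] F0(1) by blast
  have finF: "finite F" and FK: "F \<subseteq> K" and Fne: "F \<noteq> {}" and FS: "F + S \<noteq> K"
    using F(1) by (auto simp: P_def)
  have FSK: "F + S \<subseteq> K" using sK FK SK by (rule subgrp_set_plus)
  have atom: "a - b \<in> stab F" if a: "a \<in> F" and b: "b \<in> F" for a b
  proof (rule ccontr)
    define g where "g = a - b"
    define F1 where "F1 = F \<inter> (+) g ` F"
    define F2 where "F2 = F \<union> (+) g ` F"
    assume "a - b \<notin> stab F"
    then have "(+) g ` F \<noteq> F" by (simp add: stab_iff g_def)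
    then have "F1 \<subset> F"
      unfolding F1_def using card_subset_eq[of "(+) g ` F" F] finF by (auto simp: card_translate)
    then have lt: "card F1 < card F" using finF by (simp add: psubset_card_mono)
    have "a \<in> F1" using a b by (simp add: F1_def g_def mem_translate)
    have gK: "g \<in> K" using a b FK sK by (auto simp: g_def intro: subgrp_diff)
    have c12: "card F1 + card F2 = 2 * card F"
      using card_Un_Int[of F "(+) g ` F"] finF by (simp add: F1_def F2_def card_translate)
    have fin12: "finite F1" "finite F2" using finF by (auto simp: F1_def F2_def)
    have F1S: "F1 + S \<subseteq> (F + S) \<inter> (+) g ` (F + S)"
      unfolding F1_def translate_set_plus[symmetric] by (auto simp: set_plus_def)
    have F2S: "F2 + S = (F + S) \<union> (+) g ` (F + S)"
      unfolding F2_def translate_set_plus[symmetric] by (rule Un_set_plus)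
    have "card (F1 + S) \<le> card ((F + S) \<inter> (+) g ` (F + S))"
      using F1S fin[OF finF] by (intro card_mono) auto
    \<comment> \<open>Together with \<open>c12\<close> this is submodularity: the boundaries of
      \<open>F1\<close> and \<open>F2\<close> add up to at most twice that of
      \<open>F\<close>.\<close>
    then have sm: "card (F1 + S) + card (F2 + S) \<le> 2 * card (F + S)"
      using card_Un_Int[of "F + S" "(+) g ` (F + S)"] fin[OF finF] F2S by (simp add: card_translate)
    have "F1 + S \<noteq> K" using F1S FS FSK by blast
    then have P1: "P F1" using \<open>a \<in> F1\<close> fin12 FK by (auto simp: P_def F1_def)
    then have bd1: "bd F < bd F1"
      using F0(2)[of F1] F(2) F(3)[of F1] lt by (metis le_neq_implies_less not_less)
    have "F2 \<subseteq> K" using FK gK sK by (auto simp: F2_def intro: subgrp_add)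
    show False
    proof (cases "F2 + S = K")
      case False
      then have "P F2" using \<open>F2 \<subseteq> K\<close> fin12 Fne by (auto simp: P_def F2_def)
      then have "bd F \<le> bd F2" using F0(2) F(2) by simp
      then show False using sm c12 bd1 bd[OF fin12(1)] bd[OF fin12(2)] bd[OF finF] by linarith
    next
      case True
      then have finK: "finite K" using fin[OF fin12(2)] by simp
      define D where "D = K - (F + S)"
      have DS: "D + S \<subseteq> K - F"
      proof
        fix x assume "x \<in> D + S"
        then obtain d s where x: "x = d + s" "d \<in> D" "s \<in> S" by (rule set_plus_elim)
        have "x \<notin> F"
        proof
          assume "x \<in> F"
          then have "x + - s \<in> F + S" using S(3) x(3) by blast
          then show False using x by (simp add: D_def)
        qed
        then show "x \<in> K - F" using x SK sK by (auto simp: D_def intro: subgrp_add)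
      qed
      have finD: "finite D" using finK by (simp add: D_def)
      have PD: "P D" using DS Fne FK FS FSK finD by (auto simp: P_def D_def)
      have cD: "card D + card (F + S) = card K"
        using card_Diff_subset[OF fin[OF finF] FSK] card_mono[OF finK FSK] by (simp add: D_def)
      have "card (D + S) \<le> card (K - F)" using DS finK by (simp add: card_mono)
      then have "card (D + S) + card F \<le> card K"
        using card_Diff_subset[OF finF FK] card_mono[OF finK FK] by linarith
      then have "bd D \<le> bd F" using cD bd[OF finD] bd[OF finF] by linarith
      then have "bd D = bd F0" using F0(2)[OF PD] F(2) by simp
      then have "card F \<le> card D" using F(3) PD by blast
      \<comment> \<open>Since \<open>F2 + S = K\<close>, \<open>sm\<close> and \<open>cD\<close>
        bound \<open>card (F1 + S)\<close> by \<open>card (F + S) - card D\<close>, hence by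
        \<open>bd F\<close>, which is less than \<open>bd F1\<close>.\<close>
      then show False
        using sm True cD bd1 bd[OF fin12(1)] bd[OF finF] \<open>a \<in> F1\<close> fin12(1)
        by (auto simp: card_eq_0_iff)
    qed
  qed
  obtain a where a: "a \<in> F" using Fne by blast
  have "\<not> S \<subseteq> stab F"
  proof
    assume "S \<subseteq> stab F"
    then have KF: "K \<subseteq> stab F" unfolding K by (simp add: subset_hull subgrp_stab)
    have "K \<subseteq> F"
    proof
      fix x assume "x \<in> K"
      then have "x - a \<in> stab F" using KF a FK sK by (auto intro: subgrp_diff)
      then show "x \<in> F" using stab_add_mem[OF _ a] by fastforce
    qed
    then show False using sub[of F] FS FSK by blast
  qed
  then obtain s where s: "s \<in> S" "s \<notin> stab F" by blast
  \<comment> \<open>A common element would exhibit \<open>s\<close> as a difference of two elements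
    of \<open>F\<close>, and such differences stabilize \<open>F\<close>.\<close>
  have disj: "F \<inter> (+) s ` F = {}"
    using atom s(2) by (force simp: mem_translate)
  have "F \<union> (+) s ` F \<subseteq> F + S" using sub s(1) by (auto simp: add.commute[of s])
  then have "card (F \<union> (+) s ` F) \<le> card (F + S)" using fin[OF finF] by (rule card_mono[rotated])
  then have "2 * card F \<le> card (F + S)"
    using card_Un_disjoint[OF finF _ disj] finF by (simp add: card_translate)
  moreover have "card S \<le> card (F + S)" using finF S(1) a by (rule card_subset_set_plus)
  ultimately have "card S \<le> 2 * bd F" using bd[OF finF] by linarith
  then show ?thesis using F0(2)[OF PA] F(2) bd[OF A(1)] by linarith
qed

section \<open>The excess of a set under translation\<close>

text \<open>Olson's function: it measures the growth of \<open>\<Sigma>(B) + H\<close> when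
  \<open>g\<close> joins \<open>B\<close>.\<close>

definition excess :: "'a::ab_group_add set \<Rightarrow> 'a \<Rightarrow> nat" where
  "excess X g = card ((+) g ` X - X)"

lemma card_Un_translate: "finite X \<Longrightarrow> card (X \<union> (+) g ` X) = card X + excess X g"
  using card_Un_disjoint[of X "(+) g ` X - X"] by (simp add: excess_def)

lemma card_Int_translate: "finite X \<Longrightarrow> card (X \<inter> (+) g ` X) + excess X g = card X"
  using card_Un_Int[of X "(+) g ` X"] card_Un_translate[of X g] by (simp add: card_translate)

lemma excess_stab: "g \<in> stab X \<Longrightarrow> excess X g = 0"
  by (simp add: excess_def stab_iff)

text \<open>Translation by \<open>g\<close> carries \<open>X \<inter> (X - g)\<close> onto
  \<open>X \<inter> (X + g)\<close>, so the two overlaps have the same size.\<close>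

lemma excess_minus:
  assumes "finite X"
  shows "excess X (- g) = excess X g"
proof -
  have "(+) g ` (X \<inter> (+) (- g) ` X) = X \<inter> (+) g ` X"
    by (simp add: image_Int image_image Int_commute)
  then have "card (X \<inter> (+) (- g) ` X) = card (X \<inter> (+) g ` X)" by (metis card_translate)
  then show ?thesis using card_Int_translate[OF assms, of g] card_Int_translate[OF assms, of "- g"]
    by linarith
qed

text \<open>An element of \<open>g + h + X\<close> outside \<open>X\<close> lies in
  \<open>g + X\<close> or is the \<open>g\<close>-translate of an element of \<open>h + X\<close>
  outside \<open>X\<close>.\<close>

lemma excess_add:
  assumes "finite X"
  shows "excess X (g + h) \<le> excess X g + excess X h"
proof -
  have "(+) (g + h) ` X - X \<subseteq> (+) g ` ((+) h ` X - X) \<union> ((+) g ` X - X)"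
    by (auto simp: mem_translate algebra_simps)
  then have "excess X (g + h) \<le> card ((+) g ` ((+) h ` X - X) \<union> ((+) g ` X - X))"
    unfolding excess_def using assms by (intro card_mono) auto
  also have "\<dots> \<le> card ((+) g ` ((+) h ` X - X)) + card ((+) g ` X - X)" by (rule card_Un_le)
  finally show ?thesis by (simp add: card_translate excess_def)
qed

text \<open>What \<open>K - X\<close> gains under translation by \<open>g\<close> is what
  \<open>X\<close> loses, and a finite set loses as many elements as it gains.\<close>

lemma excess_compl:
  assumes "subgrp K" "finite K" "X \<subseteq> K" "g \<in> K"
  shows "excess (K - X) g = excess X g"
proof -
  have fin: "finite X" using assms finite_subset by blast
  have "(+) g ` (K - X) - (K - X) = X - (+) g ` X"
    using assms(3) subgrp_diff[OF assms(1) _ assms(4)] subgrp_add[OF assms(1) assms(4)]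
    by (auto simp: mem_translate)
  moreover have "card (X - (+) g ` X) = excess X g"
    using card_Int_translate[OF fin, of g] card_Diff_subset_Int[of X "(+) g ` X"] fin by simp
  ultimately show ?thesis by (simp add: excess_def)
qed

text \<open>Double counting: each pair of elements of \<open>X\<close> has a single difference.\<close>

lemma sum_excess_ge:
  assumes "finite X" "finite E"
  shows "card E * card X \<le> (\<Sum>g\<in>E. excess X g) + card X * card X"
proof -
  have "card E * card X = (\<Sum>g\<in>E. card (X \<inter> (+) g ` X) + excess X g)"
    using card_Int_translate[OF assms(1)] by simp
  moreover have "(\<Sum>g\<in>E. card (X \<inter> (+) g ` X)) \<le> card X * card X"
  proof -
    have "(\<Sum>g\<in>E. card (X \<inter> (+) g ` X)) = card (SIGMA g:E. X \<inter> (+) g ` X)"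
      using assms by (simp add: card_SigmaI)
    also have "\<dots> \<le> card (X \<times> X)"
      using assms(1)
      by (intro card_inj_on_le[of "\<lambda>(g, y). (y, y - g)"]) (auto simp: inj_on_def mem_translate)
    finally show ?thesis by (simp add: card_cartesian_product)
  qed
  ultimately show ?thesis by (simp add: sum.distrib)
qed

text \<open>The overlaps of \<open>X\<close> with its translates by \<open>E\<close> total at most
  \<open>|X|^2\<close>, so on average they are at most \<open>|X| / 2\<close>.\<close>

lemma ex_excess_ge:
  assumes "finite X" "finite E" "2 * card X \<le> card E" "X \<noteq> {}"
  shows "\<exists>g\<in>E. card X \<le> 2 * excess X g"
proof (rule ccontr)
  assume "\<not> ?thesis"
  then have *: "2 * excess X g + 1 \<le> card X" if "g \<in> E" for g using that by fastforce
  have "2 * (\<Sum>g\<in>E. excess X g) + card E = (\<Sum>g\<in>E. 2 * excess X g + 1)"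
    by (simp add: sum.distrib sum_distrib_left del: add_Suc_right add_0_right One_nat_def)
  also have "\<dots> \<le> card E * card X" using sum_mono[OF *, of E] by simp
  finally have "2 * (\<Sum>g\<in>E. excess X g) + card E \<le> card E * card X" .
  moreover have "2 * card X * card X \<le> card E * card X" using assms(3) by (rule mult_right_mono) simp
  moreover have "card E > 0" using assms by (metis card_gt_0_iff le_zero_eq mult_eq_0_iff neq0_conv zero_neq_numeral)
  ultimately show False using sum_excess_ge[OF assms(1,2)] by linarith
qed

section \<open>Iterated sumsets and elements of large excess\<close>

text \<open>From here on \<open>\<Sum>i<k. S\<close> is the \<open>k\<close>-fold sumset of \<open>S\<close>.\<close>

lemma finite_nfold: "finite S \<Longrightarrow> finite (\<Sum>i<k. S)"
  for S :: "'a::ab_group_add set" and k :: nat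
  by (induction k) (auto simp: finite_set_plus)

lemma nfold_subset: "subgrp K \<Longrightarrow> S \<subseteq> K \<Longrightarrow> (\<Sum>i<k. S) \<subseteq> K"
  for k :: nat
  by (induction k) (simp_all add: subgrp_zero subgrp_set_plus)

text \<open>By \<open>sumset_growth\<close> each further summand adds at least
  \<open>|S| / 2\<close> elements until the generated subgroup is filled.\<close>

lemma card_nfold_ge:
  fixes S :: "'a::ab_group_add set" and k :: nat
  assumes S: "finite S" "0 \<in> S" "\<And>x. x \<in> S \<Longrightarrow> - x \<in> S"
    and "k > 0" "(\<Sum>i<k. S) \<noteq> subgrp hull S"
  shows "(k + 1) * card S \<le> 2 * card (\<Sum>i<k. S)"
  using assms(4,5)
proof (induction k rule: nat_induct_non_zero)
  case (Suc k)
  let ?T = "\<Sum>i<k. S" and ?K = "subgrp hull S"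
  have TK: "?T \<subseteq> ?K" "?T + S \<subseteq> ?K"
    using nfold_subset[OF subgrp_hull hull_subset, of S k]
      nfold_subset[OF subgrp_hull hull_subset, of S "Suc k"] by auto
  have le: "?T \<subseteq> ?T + S" using set_zero_plus2[OF S(2), of ?T] by (simp add: add.commute)
  have ne: "?T + S \<noteq> ?K" using Suc.prems by simp
  then have "?T \<noteq> ?K" using TK le by blast
  then have IH: "(k + 1) * card S \<le> 2 * card ?T" by (rule Suc.IH)
  moreover have "?T \<noteq> {}" using IH S(1,2) by (auto simp: card_eq_0_iff)
  then have "2 * card ?T + card S \<le> 2 * card (?T + S)"
    using sumset_growth[OF S refl finite_nfold[OF S(1)]] TK(1) ne by blast
  ultimately show ?case by simp
qed simp

text \<open>A sumset that does not fill the subgroup has at least half as many elements as summands,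
  so \<open>2 * N + 1\<close> summands suffice; a filled subgroup is large by
  \<open>N\<close>.\<close>

lemma ex_large_nfold:
  fixes S :: "'a::ab_group_add set"
  assumes S: "finite S" "0 \<in> S" "\<And>x. x \<in> S \<Longrightarrow> - x \<in> S"
    and N: "finite (subgrp hull S) \<Longrightarrow> N \<le> card (subgrp hull S)"
  shows "\<exists>k::nat. N \<le> card (\<Sum>i<k. S)"
proof -
  define j where "j = 2 * N + 1"
  have "N \<le> card (\<Sum>i<j. S)"
  proof (cases "(\<Sum>i<j. S) = subgrp hull S")
    case True
    then show ?thesis using N finite_nfold[OF S(1), of j] by simp
  next
    case False
    have "card S > 0" using S(1,2) by (auto simp: card_gt_0_iff)
    then have "(j + 1) * 1 \<le> (j + 1) * card S" by (intro mult_le_mono2) simp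
    also have "\<dots> \<le> 2 * card (\<Sum>i<j. S)"
      by (rule card_nfold_ge[OF S _ False]) (simp_all add: j_def)
    finally show ?thesis by (simp add: j_def)
  qed
  then show ?thesis ..
qed

lemma excess_nfold_le:
  fixes k :: nat
  assumes "finite X" "\<And>g. g \<in> S \<Longrightarrow> excess X g \<le> L" "h \<in> (\<Sum>i<k. S)"
  shows "excess X h \<le> k * L"
  using assms(3)
proof (induction k arbitrary: h)
  case 0
  then show ?case by (simp add: excess_def)
next
  case (Suc k)
  then obtain a b where ab: "h = a + b" "a \<in> (\<Sum>i<k. S)" "b \<in> S"
    by (auto elim: set_plus_elim)
  then show ?case
    using excess_add[OF assms(1), of a b] Suc.IH[OF ab(2)] assms(2)[OF ab(3)] by simp
qed

text \<open>Some element of the first \<open>k\<close>-fold sumset of size at least \<open>2|X|\<close> has excess at least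
  \<open>|X|/2\<close> by averaging. Excess is subadditive, so the excess on \<open>S\<close> reaches \<open>|X|/(2k)\<close>, and
  \<open>k|S| < 4|X|\<close> by minimality of \<open>k\<close>.\<close>

lemma ex_large_excess_half:
  fixes S :: "'a::ab_group_add set"
  assumes S: "finite S" "0 \<in> S" "\<And>x. x \<in> S \<Longrightarrow> - x \<in> S"
    and X: "finite X" "X \<noteq> {}" "finite (subgrp hull S) \<Longrightarrow> 2 * card X \<le> card (subgrp hull S)"
  shows "\<exists>g\<in>S. card X \<le> 2 * excess X g \<or> card S < 8 * excess X g"
proof -
  have cX: "card X > 0" using X by (simp add: card_gt_0_iff)
  define k where "k = (LEAST k::nat. 2 * card X \<le> card (\<Sum>i<k. S))"
  have k: "2 * card X \<le> card (\<Sum>i<k. S)"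
    unfolding k_def by (rule LeastI_ex) (rule ex_large_nfold[OF S X(3)])
  have less: "card (\<Sum>i<j. S) < 2 * card X" if "j < k" for j
    using not_less_Least[OF that[unfolded k_def]] by simp
  obtain g where g: "g \<in> (\<Sum>i<k. S)" "card X \<le> 2 * excess X g"
    using ex_excess_ge[OF X(1) finite_nfold[OF S(1)] k X(2)] by blast
  have "Max (excess X ` S) \<in> excess X ` S" using S by (intro Max_in) auto
  then obtain c where c: "c \<in> S" "excess X c = Max (excess X ` S)" by force
  have max: "excess X h \<le> excess X c" if "h \<in> S" for h
    using that c(2) S(1) by simp
  have "k \<noteq> 0" using k cX by (intro notI) simp
  then consider "k = 1" | j where "k = Suc j" "j > 0" by (cases k) auto
  then show ?thesis
  proof cases
    case 1
    then show ?thesis using g by auto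
  next
    case (2 j)
    have lj: "card (\<Sum>i<j. S) < 2 * card X" by (rule less) (simp add: 2(1))
    have "(\<Sum>i<j. S) \<noteq> subgrp hull S"
    proof
      assume "(\<Sum>i<j. S) = subgrp hull S"
      then show False using lj X(3) finite_nfold[OF S(1), of j] by simp
    qed
    then have "(j + 1) * card S \<le> 2 * card (\<Sum>i<j. S)" using card_nfold_ge[OF S 2(2)] by blast
    then have "k * card S \<le> 2 * card (\<Sum>i<j. S)" using 2(1) by simp
    also have "\<dots> < 4 * card X" using lj by simp
    also have "\<dots> \<le> 8 * excess X g" using g(2) by simp
    also have "\<dots> \<le> k * (8 * excess X c)" using excess_nfold_le[OF X(1) max g(1)] by simp
    finally have "card S < 8 * excess X c" by simp
    then show ?thesis using c(1) by blast
  qed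
qed

text \<open>A weak form of a lemma of Olson. The excesses of \<open>X\<close> and of its complement in \<open>K\<close> agree,
  so one may pass to the smaller of the two.\<close>

lemma ex_large_excess:
  fixes S :: "'a::ab_group_add set"
  assumes S: "finite S" "0 \<in> S" "\<And>x. x \<in> S \<Longrightarrow> - x \<in> S"
    and K: "K = subgrp hull S"
    and X: "finite X" "X \<noteq> {}" "X \<subseteq> K" "X \<noteq> K"
  shows "\<exists>g\<in>S. card X \<le> 2 * excess X g \<or> (finite K \<and> card (K - X) \<le> 2 * excess X g) \<or>
    card S < 8 * excess X g"
proof (cases "finite K \<and> card K < 2 * card X")
  case True
  then have fin: "finite K" and "card (K - X) = card K - card X"
    using X by (auto simp: card_Diff_subset)
  then have "2 * card (K - X) \<le> card K" using True by linarith
  then obtain g where g: "g \<in> S" "card (K - X) \<le> 2 * excess (K - X) g \<or> card S < 8 * excess (K - X) g"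
    using ex_large_excess_half[OF S, of "K - X"] fin X K by auto
  have "g \<in> K" using g(1) unfolding K by (rule hull_inc)
  then have "excess (K - X) g = excess X g"
    using excess_compl[OF _ fin X(3)] K subgrp_hull by blast
  then show ?thesis using g fin by auto
next
  case False
  then show ?thesis using ex_large_excess_half[OF S X(1,2)] K by fastforce
qed

section \<open>Subset sums modulo a finite subgroup\<close>

lemma subset_sums_Un:
  assumes "finite A" "finite B" "A \<inter> B = {}"
  shows "subset_sums (A \<union> B) = subset_sums A + subset_sums B"
proof (intro subset_antisym subsetI)
  fix x assume "x \<in> subset_sums (A \<union> B)"
  then obtain D where D: "D \<subseteq> A \<union> B" "x = \<Sum>D" by (auto simp: subset_sums_def)
  have "\<Sum>((D \<inter> A) \<union> (D \<inter> B)) = \<Sum>(D \<inter> A) + \<Sum>(D \<inter> B)"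
    using assms by (intro sum.union_disjoint) auto
  moreover have "(D \<inter> A) \<union> (D \<inter> B) = D" using D(1) by blast
  ultimately have "x = \<Sum>(D \<inter> A) + \<Sum>(D \<inter> B)" using D(2) by simp
  moreover have "\<Sum>(D \<inter> A) \<in> subset_sums A" "\<Sum>(D \<inter> B) \<in> subset_sums B"
    by (auto simp: subset_sums_def)
  ultimately show "x \<in> subset_sums A + subset_sums B" by blast
next
  fix x assume "x \<in> subset_sums A + subset_sums B"
  then obtain D E where DE: "D \<subseteq> A" "E \<subseteq> B" "x = \<Sum>D + \<Sum>E"
    by (auto simp: subset_sums_def elim!: set_plus_elim)
  then have "\<Sum>(D \<union> E) = x"
    using assms by (subst sum.union_disjoint) (auto dest: finite_subset)
  moreover have "D \<union> E \<subseteq> A \<union> B" using DE by blast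
  ultimately show "x \<in> subset_sums (A \<union> B)" by (auto simp: subset_sums_def)
qed

lemma subset_sums_singleton: "subset_sums {a} = {0, a}"
proof -
  have "subset_sums {a} = sum (\<lambda>x. x) ` Pow {a}" by (auto simp: subset_sums_def)
  then show ?thesis by (simp add: Pow_insert insert_commute)
qed

lemma subset_sums_insert:
  assumes "finite A" "a \<notin> A"
  shows "subset_sums (insert a A) = subset_sums A \<union> (+) a ` subset_sums A"
  using subset_sums_Un[of "{a}" A] assms by (simp add: subset_sums_singleton insert_set_plus Un_commute)

lemma subset_sums_mono: "A \<subseteq> B \<Longrightarrow> subset_sums A \<subseteq> subset_sums B"
  by (auto simp: subset_sums_def)

lemma subset_sums_subgrp: "subgrp K \<Longrightarrow> A \<subseteq> K \<Longrightarrow> subset_sums A \<subseteq> K"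
  by (auto simp: subset_sums_def intro: subgrp_sum)

lemma finite_subset_sums_plus: "finite A \<Longrightarrow> finite H \<Longrightarrow> finite (subset_sums A + H)"
  by (simp add: finite_set_plus finite_subset_sums)

lemma subset_sums_plus_ne: "subgrp H \<Longrightarrow> subset_sums A + H \<noteq> {}"
  using zero_in_subset_sums[of A] subgrp_zero[of H] by blast

lemma card_subset_sums_insert:
  assumes "finite A" "finite H" "a \<notin> A"
  shows "card (subset_sums (insert a A) + H) =
    card (subset_sums A + H) + excess (subset_sums A + H) a"
  using card_Un_translate[OF finite_subset_sums_plus[OF assms(1,2)]] assms
  by (simp add: subset_sums_insert Un_set_plus translate_set_plus)

lemma subset_stab_plus: "subgrp H \<Longrightarrow> H \<subseteq> stab (X + H)"
proof -
  assume H: "subgrp H"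
  have "(+) h ` H = H" if "h \<in> H" for h
    using that subgrp_add_cancel[OF H, of h] subgrp_add[OF H] subgrp_diff[OF H]
    by (auto simp: mem_translate)
  then have "H \<subseteq> stab H" by (auto simp: stab_iff)
  also have "stab H \<subseteq> stab (X + H)" using stab_set_plus[of H X] by (simp add: add.commute)
  finally show ?thesis .
qed

lemma subset_sums_plus_Un:
  assumes "subgrp H" "finite A" "finite B" "A \<inter> B = {}"
  shows "subset_sums (A \<union> B) + H = (subset_sums A + H) + (subset_sums B + H)"
  using subset_sums_Un[OF assms(2-4)] subgrp_plus_self[OF assms(1)]
  by (metis add.assoc add.commute)

text \<open>\<open>\<Sigma>(B) + H\<close> is a summand of \<open>\<Sigma>(A) + H\<close>, and
  whatever stabilizes a summand stabilizes the sum.\<close>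

lemma stab_subset_sums_subset:
  assumes "subgrp H" "finite A" "stab (subset_sums A + H) = H" "B \<subseteq> A"
  shows "stab (subset_sums B + H) = H"
proof -
  have "subset_sums (B \<union> (A - B)) + H = (subset_sums B + H) + (subset_sums (A - B) + H)"
    using assms by (intro subset_sums_plus_Un) (auto dest: finite_subset)
  then have "stab (subset_sums B + H) \<subseteq> stab (subset_sums A + H)"
    using stab_set_plus[of "subset_sums B + H"] assms(4) by (simp add: Un_absorb1)
  then show ?thesis using subset_stab_plus[OF assms(1)] assms(3) by blast
qed

lemma card_subset_sums_linear:
  assumes "subgrp H" "finite H" "finite A" "A \<inter> H = {}" "stab (subset_sums A + H) = H"
  shows "card H + card A \<le> card (subset_sums A + H)"
  using assms(3-5)
proof (induction A)
  case empty
  then show ?case by (simp add: subset_sums_def)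
next
  case (insert a A)
  have st: "stab (subset_sums A + H) = H"
    using stab_subset_sums_subset[OF assms(1) _ insert.prems(2)] insert.hyps by blast
  have "a \<notin> stab (subset_sums A + H)" using st insert.prems by blast
  then have "\<not> (+) a ` (subset_sums A + H) \<subseteq> subset_sums A + H"
    unfolding stab_iff
    using translate_subset_eq[OF finite_subset_sums_plus[OF insert.hyps(1) assms(2)]] by blast
  then have "excess (subset_sums A + H) a \<noteq> 0"
    using finite_subset_sums_plus[OF insert.hyps(1) assms(2)] by (simp add: excess_def)
  then show ?case
    using insert st card_subset_sums_insert[OF insert.hyps(1) assms(2) insert.hyps(2)] by simp
qed

section \<open>The greedy step and its growth\<close>

lemma subset_sums_greedy_step:
  assumes H: "subgrp H" "finite H"
    and A: "finite A" "A \<inter> H = {}" "stab (subset_sums A + H) = H"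
    and B: "B \<subseteq> A" "B \<noteq> A"
    and gen: "A \<subseteq> subgrp hull ((A - B) \<union> H)"
  shows "\<exists>c\<in>A - B. card (subset_sums B + H) \<le> 2 * excess (subset_sums B + H) c \<or>
    card (A - B) + 2 \<le> 8 * excess (subset_sums B + H) c"
proof -
  define C where "C = A - B"
  define X where "X = subset_sums B + H"
  define K where "K = subgrp hull (C \<union> H)"
  \<comment> \<open>Symmetric and containing \<open>0\<close>, as \<open>ex_large_excess\<close>
    requires. The summand \<open>H\<close> puts \<open>H\<close> into the generated subgroup, and
    shifting by its elements does not affect excesses of \<open>X\<close>.\<close>
  define S where "S = (C \<union> uminus ` C \<union> {0}) + H"
  have sK: "subgrp K" unfolding K_def by (rule subgrp_hull)
  have CHK: "C \<union> H \<subseteq> K" unfolding K_def by (rule hull_subset)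
  have AK: "A \<subseteq> K" using gen by (simp add: K_def C_def)
  have H0: "0 \<in> H" by (rule subgrp_zero[OF H(1)])
  have fin: "finite B" "finite C" using A(1) B(1) finite_subset by (auto simp: C_def)
  have finX: "finite X" unfolding X_def by (rule finite_subset_sums_plus[OF fin(1) H(2)])
  have finS: "finite S" unfolding S_def using fin(2) H(2) by (intro finite_set_plus) auto
  have SI: "u + h \<in> S" if "u \<in> C \<union> uminus ` C \<union> {0}" "h \<in> H" for u h
    unfolding S_def using that by (rule set_plus_intro)
  have CHS: "C \<union> H \<subseteq> S"
    using SI[OF _ H0] SI[of 0] by auto
  have sym: "- x \<in> S" if x: "x \<in> S" for x
  proof -
    obtain u h where uh: "x = u + h" "u \<in> C \<union> uminus ` C \<union> {0}" "h \<in> H"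
      using x unfolding S_def by (rule set_plus_elim)
    have "- u + - h \<in> S" using uh subgrp_minus[OF H(1)] by (intro SI) auto
    then show ?thesis using uh(1) by simp
  qed
  have "S \<subseteq> K"
    unfolding S_def using CHK sK by (intro subgrp_set_plus) (auto simp: subgrp_zero subgrp_minus)
  then have hullS: "subgrp hull S = K"
    using CHS by (intro hull_unique) (auto simp: K_def subset_hull subgrp_hull)
  have XK: "X \<subseteq> K"
    unfolding X_def using sK AK B(1) CHK by (intro subgrp_set_plus subset_sums_subgrp) auto
  have st: "stab (subset_sums C + H) = H"
    by (rule stab_subset_sums_subset[OF H(1) A(1,3)]) (auto simp: C_def)
  have "card H + card C \<le> card (subset_sums C + H)"
    using A(2) by (intro card_subset_sums_linear[OF H fin(2) _ st]) (auto simp: C_def)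
  moreover have cH: "card H > 0" using H(2) H0 by (auto simp: card_gt_0_iff)
  ultimately have cC: "card C < card (subset_sums C + H)" by linarith
  \<comment> \<open>Otherwise, by pigeonhole, \<open>x - (\<Sigma>(C) + H)\<close> meets
    \<open>X\<close> for every \<open>x\<close> in \<open>K\<close>, so
    \<open>\<Sigma>(A) + H = K\<close>. Its stabilizer \<open>H\<close> then contains the nonempty
    set \<open>A\<close>, which is disjoint from \<open>H\<close>.\<close>
  have big: "card C < card (K - X)" if finK: "finite K"
  proof (rule ccontr)
    assume "\<not> ?thesis"
    then have lt: "card (K - X) < card (subset_sums C + H)" using cC by simp
    have "K \<subseteq> X + (subset_sums C + H)"
    proof
      fix x assume x: "x \<in> K"
      let ?Y = "(\<lambda>y. x - y) ` (subset_sums C + H)"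
      have "subset_sums C + H \<subseteq> K"
        using sK CHK by (intro subgrp_set_plus subset_sums_subgrp) auto
      then have "?Y \<subseteq> K" using x sK by (auto intro: subgrp_diff)
      moreover have "card ?Y = card (subset_sums C + H)" by (intro card_image) (auto simp: inj_on_def)
      ultimately have "\<not> ?Y \<subseteq> K - X" using lt finK card_mono[of "K - X" ?Y] by auto
      then obtain y where "y \<in> subset_sums C + H" "x - y \<in> X" using \<open>?Y \<subseteq> K\<close> by blast
      then have "(x - y) + y \<in> X + (subset_sums C + H)" by blast
      then show "x \<in> X + (subset_sums C + H)" by simp
    qed
    also have "X + (subset_sums C + H) = subset_sums (B \<union> C) + H"
      unfolding X_def using fin by (intro subset_sums_plus_Un[OF H(1), symmetric]) (auto simp: C_def)
    also have "B \<union> C = A" using B(1) by (auto simp: C_def)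
    finally have "K \<subseteq> subset_sums A + H" .
    moreover have "subset_sums A + H \<subseteq> K"
      using sK AK CHK by (intro subgrp_set_plus subset_sums_subgrp) auto
    ultimately have "subset_sums A + H = K" by blast
    moreover have "K \<subseteq> stab K" using subset_stab_plus[OF sK, of K] subgrp_plus_self[OF sK] by simp
    ultimately have "A \<subseteq> H" using A(3) AK by simp
    then show False using A(2) B by blast
  qed
  have "X \<noteq> K" using big finX by auto
  moreover have Xne: "X \<noteq> {}" unfolding X_def by (rule subset_sums_plus_ne[OF H(1)])
  ultimately obtain g where g: "g \<in> S"
      "card X \<le> 2 * excess X g \<or> (finite K \<and> card (K - X) \<le> 2 * excess X g) \<or>
        card S < 8 * excess X g"
    using ex_large_excess[OF finS _ sym hullS[symmetric] finX _ XK] CHS H0 by blast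
  obtain u h where uh: "g = u + h" "u \<in> C \<union> uminus ` C \<union> {0}" "h \<in> H"
    using g(1) unfolding S_def by (rule set_plus_elim)
  have "h \<in> stab X" using subset_stab_plus[OF H(1)] uh(3) by (auto simp: X_def)
  then have le: "excess X g \<le> excess X u"
    using excess_add[OF finX, of u h] uh(1) by (simp add: excess_stab)
  have "card X > 0" using finX Xne by (simp add: card_gt_0_iff)
  then have "excess X g > 0" using g(2) big by auto
  then have "u \<noteq> 0" using le by (auto simp: excess_def)
  then obtain c where c: "c \<in> C" "excess X u = excess X c"
    using uh(2) excess_minus[OF finX] by auto
  have "card C + card H = card (C \<union> H)"
    using fin(2) H(2) A(2) by (intro card_Un_disjoint[symmetric]) (auto simp: C_def)
  also have "\<dots> \<le> card S" using CHS finS by (rule card_mono[rotated])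
  finally have "card C + 1 \<le> card S" using cH by linarith
  \<comment> \<open>By \<open>big\<close> the alternative with \<open>K - X\<close> gives
    \<open>card C + 1 \<le> 2 * excess X c\<close>, which implies the second one here.\<close>
  then have "card X \<le> 2 * excess X c \<or> card C + 2 \<le> 8 * excess X c"
    using g(2) big le c(2) by linarith
  then show ?thesis using c(1) unfolding C_def X_def by blast
qed

text \<open>For large \<open>i\<close> the quantity \<open>y\<close> is compared with \<open>g (i - 1)\<close>, where \<open>g\<close> has slope \<open>min z w\<close>.
  The comparison propagates only from \<open>z = 4\<close> on, so the first five values, at least
  1, 2, 4, 7, 11, are computed by hand, rounding \<open>(y + 1) / 2\<close> up.\<close>

lemma greedy_growth_bound:
  fixes Q :: "nat \<Rightarrow> nat \<Rightarrow> bool"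
  assumes n: "n > 64" and Q0: "Q 0 0"
    and step: "\<And>i y. Q i y \<Longrightarrow> 7 * i + 7 \<le> 2 * n \<Longrightarrow>
      \<exists>e. (y + 1 \<le> 2 * e \<or> n + 2 \<le> 8 * e + i) \<and> Q (Suc i) (y + e)"
  shows "\<exists>i y. Q i y \<and> n\<^sup>2 \<le> 64 * y"
proof -
  \<comment> \<open>As long as \<open>7 * i \<le> 2 * n\<close>, the bound
    \<open>n + 2 \<le> 8 * e + i\<close> forces \<open>8 * e \<ge> 5 * n / 7\<close>, that is,
    \<open>e \<ge> w\<close>.\<close>
  define w :: real where "w = 5 * real n / 56"
  \<comment> \<open>The parabola up to \<open>w\<close>, continued by its tangent there.\<close>
  define g where "g z = (if z \<le> w then z\<^sup>2 / 2 else w * z - w\<^sup>2 / 2)" for z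
  have w: "w \<ge> 5" using n by (simp add: w_def)
  have g_le: "g z \<le> z\<^sup>2 / 2" for z
  proof -
    have "0 \<le> (z - w)\<^sup>2" by simp
    then show ?thesis by (simp add: g_def power2_eq_square algebra_simps)
  qed
  have g_le': "g (z + 1) \<le> g z + w" for z
  proof -
    have "0 \<le> (z - w)\<^sup>2" by simp
    then show ?thesis by (simp add: g_def power2_eq_square algebra_simps)
  qed
  have g_step: "g (z + 1) \<le> y + e" if z: "z \<ge> 4" and y: "g z \<le> y" and e: "y + 1 \<le> 2 * e \<or> w \<le> e"
    for z y e
  proof (cases "w \<le> e")
    case True
    then show ?thesis using g_le'[of z] y by linarith
  next
    case False
    then have e: "y + 1 \<le> 2 * e" using e by blast
    show ?thesis
    proof (cases "z \<le> w")
      case True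
      \<comment> \<open>With \<open>y = z^2 / 2\<close>, gaining \<open>(y + 1) / 2\<close> reaches
        \<open>(z + 1)^2 / 2\<close> exactly when \<open>z \<le> z^2 / 4\<close>.\<close>
      have "0 \<le> z * (z - 4)" using z by simp
      then show ?thesis using g_le[of "z + 1"] True y e
        by (simp add: g_def power2_eq_square algebra_simps)
    next
      case False
      have "0 \<le> w * (z - w)" using False w by simp
      moreover have "0 \<le> w * (w - 4)" using w by simp
      ultimately show ?thesis using g_le'[of z] False y e
        by (simp add: g_def power2_eq_square algebra_simps)
    qed
  qed
  \<comment> \<open>\<open>2 * k \<le> y + 2\<close> encodes the rounding up. The cap
    \<open>6\<close> is what the other alternative guarantees for \<open>n > 64\<close>.\<close>
  have Q_step: "\<exists>y'. Q (Suc i) y' \<and> y + k \<le> y'"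
    if Q: "Q i y'" and i: "7 * i + 7 \<le> 2 * n" and k: "y \<le> y'" "2 * k \<le> y + 2" "k \<le> 6" for i y k y'
  proof -
    obtain e where e: "y' + 1 \<le> 2 * e \<or> n + 2 \<le> 8 * e + i" "Q (Suc i) (y' + e)"
      using step[OF Q i] by blast
    have "k \<le> e" using e(1)
    proof
      assume "y' + 1 \<le> 2 * e"
      then show ?thesis using k(1,2) by linarith
    next
      assume "n + 2 \<le> 8 * e + i"
      then have "48 \<le> 8 * e" using i n by linarith
      then show ?thesis using k(3) by linarith
    qed
    then show ?thesis using e(2) k(1) by (intro exI[of _ "y' + e"]) simp
  qed
  obtain y1 where "Q 1 y1" "1 \<le> y1" using Q_step[OF Q0, of 0 1] n by auto
  then obtain y2 where "Q 2 y2" "2 \<le> y2"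
    using Q_step[of 1 y1 1 1] n by (auto simp: numeral_2_eq_2)
  then obtain y3 where "Q 3 y3" "4 \<le> y3"
    using Q_step[of 2 y2 2 2] n by (auto simp: eval_nat_numeral)
  then obtain y4 where "Q 4 y4" "7 \<le> y4"
    using Q_step[of 3 y3 4 3] n by (auto simp: eval_nat_numeral)
  then obtain y5 where y5: "Q 5 y5" "11 \<le> y5"
    using Q_step[of 4 y4 7 4] n by (auto simp: eval_nat_numeral)
  \<comment> \<open>The index is shifted by one because \<open>g 4 = 8\<close>, while four steps
    guarantee only \<open>7\<close>; the fifth guarantees \<open>11\<close>.\<close>
  have main: "7 * i \<le> 2 * n \<Longrightarrow> \<exists>y. Q i y \<and> g (real i - 1) \<le> real y" if "i \<ge> 5" for i
    using that
  proof (induction i rule: dec_induct)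
    case base
    have "g (real 5 - 1) \<le> 11" using g_le[of 4] by simp
    then show ?case using y5 by (intro exI[of _ y5]) auto
  next
    case (step i)
    then obtain y where y: "Q i y" "g (real i - 1) \<le> real y" by auto
    obtain e where e: "y + 1 \<le> 2 * e \<or> n + 2 \<le> 8 * e + i" "Q (Suc i) (y + e)"
      using assms(3)[OF y(1)] step.prems by auto
    have "real y + 1 \<le> 2 * real e \<or> w \<le> real e"
      using e(1) step.prems by (auto simp: w_def)
    then have "g (real i - 1 + 1) \<le> real y + real e" using step.hyps y(2) by (intro g_step) auto
    then show ?case using e(2) by (intro exI[of _ "y + e"]) simp
  qed
  define t where "t = 2 * n div 7"
  have t: "7 * t \<le> 2 * n" "2 * n \<le> 7 * t + 6" "t \<ge> 5" using n by (auto simp: t_def)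
  obtain y where y: "Q t y" "g (real t - 1) \<le> real y" using main[OF t(3,1)] by blast
  have z: "real t - 1 \<ge> (2 * real n - 13) / 7" using t(2) by (simp add: field_simps)
  have "(2 * real n - 13) / 7 > w" using n by (simp add: w_def field_simps)
  then have "g (real t - 1) = w * (real t - 1) - w\<^sup>2 / 2" using z by (simp add: g_def)
  also have "\<dots> \<ge> w * ((2 * real n - 13) / 7) - w\<^sup>2 / 2" using z w by (simp add: mult_left_mono)
  finally have "w * ((2 * real n - 13) / 7) - w\<^sup>2 / 2 \<le> real y" using y(2) by linarith
  moreover have "(real n)\<^sup>2 / 64 \<le> w * ((2 * real n - 13) / 7) - w\<^sup>2 / 2"
  proof -
    \<comment> \<open>This product is \<open>6272\<close> times the difference of the two
      sides.\<close>
    have "0 \<le> real n * (37 * real n - 1040)" using n by simp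
    then show ?thesis by (simp add: w_def power2_eq_square field_simps)
  qed
  ultimately have "real (n\<^sup>2) \<le> real (64 * y)" by simp
  then have "n\<^sup>2 \<le> 64 * y" by (simp only: of_nat_le_iff)
  then show ?thesis using y(1) by blast
qed

section \<open>The quadratic bound by induction on \<open>card A\<close>\<close>

lemma card_subset_sums_quadratic:
  assumes H: "subgrp H" "finite H"
    and A: "finite A" "A \<inter> H = {}" "stab (subset_sums A + H) = H"
  shows "64 * card H + (card A)\<^sup>2 \<le> 64 * card (subset_sums A + H)"
  using A
proof (induction "card A" arbitrary: A rule: less_induct)
  case less
  note A = less.prems
  define n where "n = card A"
  consider (small) "n \<le> 64"
    | (subgroup) L where "subgrp L" "H \<subseteq> L" "\<not> A \<subseteq> L" "n\<^sup>2 \<le> 2 * (card (A \<inter> L))\<^sup>2"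
    | (greedy) "n > 64" "\<And>L. subgrp L \<Longrightarrow> H \<subseteq> L \<Longrightarrow> n\<^sup>2 \<le> 2 * (card (A \<inter> L))\<^sup>2 \<Longrightarrow> A \<subseteq> L"
    using linorder_not_le[of n 64] by blast
  then show ?case
  proof cases
    case small
    then have "(card A)\<^sup>2 \<le> 64 * card A"
      unfolding n_def power2_eq_square by (rule mult_right_mono) simp
    then show ?thesis using card_subset_sums_linear[OF H A] by linarith
  next
    case subgroup
    obtain b where b: "b \<in> A" "b \<notin> L" using subgroup(3) by blast
    let ?X = "subset_sums (A \<inter> L) + H"
    have finX: "finite ?X" using A(1) H(2) by (intro finite_subset_sums_plus) auto
    have "64 * card H + (card (A \<inter> L))\<^sup>2 \<le> 64 * card ?X"
    proof (rule less.hyps)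
      show "card (A \<inter> L) < card A" using b A(1) by (intro psubset_card_mono) auto
      show "stab ?X = H" by (rule stab_subset_sums_subset[OF H(1) A(1,3)]) simp
    qed (use A(1,2) in auto)
    \<comment> \<open>Doubling the bound for \<open>A \<inter> L\<close> makes up for the factor
      \<open>2\<close> between \<open>n^2\<close> and the square of its size.\<close>
    then have "64 * card H + n\<^sup>2 \<le> 64 * (2 * card ?X)" using subgroup(4) by linarith
    also have "2 * card ?X = card (?X \<union> (+) b ` ?X)"
    proof -
      have XL: "?X \<subseteq> L"
        using subgroup(1,2) by (intro subgrp_set_plus subset_sums_subgrp) auto
      have "b + x \<notin> L" if "x \<in> ?X" for x
        using that XL b(2) subgrp_add_cancel[OF subgroup(1), of x b] by auto
      then have "?X \<inter> (+) b ` ?X = {}" using XL by blast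
      then show ?thesis using finX by (simp add: card_Un_disjoint card_translate)
    qed
    also have "?X \<union> (+) b ` ?X = subset_sums (insert b (A \<inter> L)) + H"
      using A(1) b(2) by (simp add: subset_sums_insert Un_set_plus translate_set_plus)
    also have "card \<dots> \<le> card (subset_sums A + H)"
      using b(1) A(1) H(2)
      by (intro card_mono finite_subset_sums_plus set_plus_mono2 subset_sums_mono) auto
    finally show ?thesis by (simp add: n_def)
  next
    case greedy
    \<comment> \<open>Here \<open>y\<close> is the gain over \<open>card H\<close> after
      \<open>i\<close> elements. As \<open>card H > 0\<close>, a gain of half the current set is at
      least \<open>(y + 1) / 2\<close>.\<close>
    define Q where "Q i y \<longleftrightarrow> (\<exists>B\<subseteq>A. card B = i \<and> card H + y \<le> card (subset_sums B + H))" for i y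
    have "\<exists>i y. Q i y \<and> n\<^sup>2 \<le> 64 * y"
    proof (rule greedy_growth_bound[OF greedy(1)])
      show "Q 0 0" unfolding Q_def by (rule exI[of _ "{}"]) (simp add: subset_sums_def)
    next
      fix i y assume "Q i y" and i: "7 * i + 7 \<le> 2 * n"
      then obtain B where B: "B \<subseteq> A" "card B = i" "card H + y \<le> card (subset_sums B + H)"
        by (auto simp: Q_def)
      have finB: "finite B" using B(1) A(1) by (rule finite_subset)
      have cC: "card (A - B) = n - i" using B A(1) finB by (simp add: card_Diff_subset n_def)
      have "A \<subseteq> subgrp hull ((A - B) \<union> H)"
      proof (rule greedy(2)[OF subgrp_hull])
        have "A - B \<subseteq> A \<inter> subgrp hull ((A - B) \<union> H)" by (auto intro: hull_inc)
        then have "n - i \<le> card (A \<inter> subgrp hull ((A - B) \<union> H))"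
          using card_mono[of "A \<inter> subgrp hull ((A - B) \<union> H)" "A - B"] A(1) cC by simp
        \<comment> \<open>Stopping before \<open>2n/7\<close> elements are used leaves at least
          \<open>5n/7\<close>, and \<open>(5/7)^2 = 25/49 > 1/2\<close>.\<close>
        then have "5 * n \<le> 7 * card (A \<inter> subgrp hull ((A - B) \<union> H))" using i by linarith
        then have "(5 * n)\<^sup>2 \<le> (7 * card (A \<inter> subgrp hull ((A - B) \<union> H)))\<^sup>2" by (rule power_mono) simp
        then show "n\<^sup>2 \<le> 2 * (card (A \<inter> subgrp hull ((A - B) \<union> H)))\<^sup>2"
          by (simp add: power_mult_distrib)
      qed (auto intro: hull_inc)
      moreover have "B \<noteq> A" using B(2) i greedy(1) by (auto simp: n_def)
      ultimately obtain c where c: "c \<in> A - B"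
        "card (subset_sums B + H) \<le> 2 * excess (subset_sums B + H) c \<or>
          card (A - B) + 2 \<le> 8 * excess (subset_sums B + H) c"
        using subset_sums_greedy_step[OF H A B(1)] by blast
      let ?e = "excess (subset_sums B + H) c"
      have "card H > 0" using H subgrp_zero by (auto simp: card_gt_0_iff)
      then have "y + 1 \<le> 2 * ?e \<or> n + 2 \<le> 8 * ?e + i" using c(2) B(3) cC by linarith
      moreover have "Q (Suc i) (y + ?e)"
        unfolding Q_def using c(1) B finB card_subset_sums_insert[OF finB H(2), of c]
        by (intro exI[of _ "insert c B"]) auto
      ultimately show "\<exists>e. (y + 1 \<le> 2 * e \<or> n + 2 \<le> 8 * e + i) \<and> Q (Suc i) (y + e)" by blast
    qed
    then obtain y B where y: "n\<^sup>2 \<le> 64 * y" and B: "B \<subseteq> A" "card H + y \<le> card (subset_sums B + H)"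
      by (auto simp: Q_def)
    have "card (subset_sums B + H) \<le> card (subset_sums A + H)"
      using B(1) A(1) H(2)
      by (intro card_mono finite_subset_sums_plus set_plus_mono2 subset_sums_mono) auto
    then show ?thesis using y B(2) by (simp add: n_def)
  qed
qed

theorem theorem5:
  fixes A H :: "'a::ab_group_add set"
  assumes "finite A"
    and "H = stab (subset_sums A)"
  shows "real (card (subset_sums A)) \<ge> real (card H) + 1 / 64 * (real (card (A - H)))\<^sup>2"
proof -
  have H: "subgrp H" "finite H"
    using assms by (simp_all add: subgrp_stab finite_stab_subset_sums)
  have AH: "subset_sums A + H = subset_sums A"
  proof
    show "subset_sums A + H \<subseteq> subset_sums A"
    proof
      fix x assume "x \<in> subset_sums A + H"
      then obtain a h where "x = a + h" "a \<in> subset_sums A" "h \<in> H" by (rule set_plus_elim)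
      then show "x \<in> subset_sums A"
        using assms(2) stab_add_mem[of h "subset_sums A" a] by (simp add: add.commute)
    qed
    show "subset_sums A \<subseteq> subset_sums A + H"
      using set_zero_plus2[of H "subset_sums A"] subgrp_zero[OF H(1)] by (simp add: add.commute)
  qed
  \<comment> \<open>Sums over \<open>A \<inter> H\<close> lie in \<open>H\<close> and are absorbed
    by it, so \<open>A\<close> can be replaced by \<open>A - H\<close>, which is disjoint from
    \<open>H\<close>.\<close>
  have "subset_sums A = subset_sums (A - H) + H"
  proof
    have "subset_sums ((A - H) \<union> (A \<inter> H)) = subset_sums (A - H) + subset_sums (A \<inter> H)"
      using assms(1) by (intro subset_sums_Un) auto
    moreover have "(A - H) \<union> (A \<inter> H) = A" by blast
    ultimately show "subset_sums A \<subseteq> subset_sums (A - H) + H"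
      using set_plus_mono2[OF subset_refl subset_sums_subgrp[OF H(1), of "A \<inter> H"]] by auto
    show "subset_sums (A - H) + H \<subseteq> subset_sums A"
      using set_plus_mono2[OF subset_sums_mono[of "A - H" A] subset_refl, of H] AH by auto
  qed
  then have "64 * card H + (card (A - H))\<^sup>2 \<le> 64 * card (subset_sums A)"
    using card_subset_sums_quadratic[OF H, of "A - H"] assms by auto
  then have "real (64 * card H + (card (A - H))\<^sup>2) \<le> real (64 * card (subset_sums A))"
    by (simp only: of_nat_le_iff)
  then show ?thesis by simp
qed

end
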